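(* Let $F:\mathbb{R}^n\rightrightarrows\mathbb{R}^n$ be a set-valued mapping with graph locally closed around $(\bar x,0)\in\mathrm{gph}\,F$. Assume that $F$ is SCD semismooth$^*$ at $(\bar x,0)$ and SCD regular around $(\bar x,0)$. Then for every $\eta>0$ there is a neighborhood $U$ of $\bar x$ such that for every starting point $x^{(0)}\in U$ the SCD semismooth$^*$ Newton-type method (described in the context) is well-defined and either stops after finitely many iterations at a solution of $0\in F(x)$ or produces a sequence $x^{(k)}$ converging superlinearly to $\bar x$, for any choice of $(\hat x^{(k)},\hat y^{(k)})\in\mathrm{gph}\,F$ satisfying $\|(\hat x^{(k)},\hat y^{(k)})-(\bar x,0)\|\le\eta\|x^{(k)}-\bar x\|$ and any $L^{(k)}\in\mathcal{S}^*F(\hat x^{(k)},\hat y^{(k)})$.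
   Context: Norms are Euclidean (operator norm for matrices); $\mathcal{B}_\delta(z)$ is the closed ball. $\mathrm{gph}\,F=\{(x,y)\mid y\in F(x)\}$. For a set $A$ and $\bar z\in A$, the tangent cone $T_A(\bar z)$ is the set of all $w$ for which there are $t_k\downarrow0$, $w_k\to w$ with $\bar z+t_kw_k\in A$ for all $k$. $\mathcal{Z}_n$ is the set of $n$-dimensional linear subspaces of $\mathbb{R}^{2n}=\mathbb{R}^n\times\mathbb{R}^n$ with metric $d_{\mathcal{Z}}(L_1,L_2)=\|P_1-P_2\|$, $P_i$ the orthogonal projection onto $L_i$. $L^*:=\{(-v^*,u^* )\mid(u^*,v^* )\in L^\perp\}$. For $n\times n$ matrices $B,A$, $\mathrm{rge}(B,A):=\{(Bp,Ap)\mid p\in\mathbb{R}^n\}$. $\mathcal{Z}_n^{\rm reg}$ is the set of all $L\in\mathcal{Z}_n$ such that $(y^*,0)\in L\Rightarrow y^*=0$; for $L\in\mathcal{Z}_n^{\rm reg}$, $C_L$ is the unique $n\times n$ matrix with $L=\mathrm{rge}(C_L,I)$. $\mathcal{O}_F$ is the set of $(x,y)\in\mathrm{gph}\,F$ with $T_{\mathrm{gph}\,F}(x,y)\in\mathcal{Z}_n$. For $(x,y)\in\mathrm{gph}\,F$, $\mathcal{S}^*F(x,y)$ is the set of all $L\in\mathcal{Z}_n$ for which there is a sequence $(x_k,y_k)\to(x,y)$ in $\mathcal{O}_F$ with $d_{\mathcal{Z}}(L,T_{\mathrm{gph}\,F}(x_k,y_k)^* )\to0$; $\bigcup\mathcal{S}^*F(x,y)$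 is the union of these subspaces. $F$ has the SCD property around $(x,y)$ if $\mathcal{S}^*F(x',y')\neq\emptyset$ for all $(x',y')\in\mathrm{gph}\,F$ in some neighborhood of $(x,y)$. $F$ is SCD regular around $(x,y)$ if it has the SCD property around $(x,y)$ and $\mathcal{S}^*F(x,y)\subseteq\mathcal{Z}_n^{\rm reg}$. $F$ is SCD semismooth$^*$ at $(\bar x,\bar y)\in\mathrm{gph}\,F$ if $F$ has the SCD property around $(\bar x,\bar y)$ and for every $\epsilon>0$ there is $\delta>0$ such that $|\langle x^*,x-\bar x\rangle-\langle y^*,y-\bar y\rangle|\le\epsilon\|(x,y)-(\bar x,\bar y)\|\,\|(x^*,y^* )\|$ for all $(x,y)\in\mathrm{gph}\,F\cap\mathcal{B}_\delta(\bar x,\bar y)$ and all $(y^*,x^* )\in\bigcup\mathcal{S}^*F(x,y)$. SCD semismooth$^*$ Newton-type method for $0\in F(x)$ (with parameter $\eta>0$). 1. Choose $x^{(0)}$, set $k:=0$. 2. If $0\in F(x^{(k)})$, stop. 3. Approximation step: compute $(\hat x^{(k)},\hat y^{(k)})\in\mathrm{gph}\,F$ with $\|(\hat x^{(k)},\hat y^{(k)})-(\bar x,0)\|\le\eta\|x^{(k)}-\bar x\|$ such that $\mathcal{S}^*F(\hat x^{(k)},\hat y^{(k)})\cap\mathcal{Z}_n^{\rm reg}\neq\emptyset$. 4. Newton step: select $n\times n$ matrices $A^{(k)},B^{(k)}$ with $L^{(k)}:=\mathrm{rge}({B^{(k)}}^T,{A^{(k)}}^T)\in\mathcal{S}^*F(\hat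 x^{(k)},\hat y^{(k)})\cap\mathcal{Z}_n^{\rm reg}$, let $\Delta x^{(k)}$ solve $A^{(k)}\Delta x=-B^{(k)}\hat y^{(k)}$ (equivalently $\Delta x^{(k)}=-C_{L^{(k)}}^T\hat y^{(k)}$), and set $x^{(k+1)}=\hat x^{(k)}+\Delta x^{(k)}$. 5. Set $k:=k+1$ and go to 2. "Well-defined" means that steps 3 and 4 can always be carried out. Superlinear convergence means $x^{(k)}\to\bar x$ and $\|x^{(k+1)}-\bar x\|=o(\|x^{(k)}-\bar x\|)$. *)

theory Defs
  imports "HOL-Analysis.Analysis" "HOL-Library.Landau_Symbols"
begin

(* The norm of the product type is the Euclidean one, so R^n x R^n is rendered as
   (real^'n) \<times> (real^'n), with n = CARD('n). *)
type_synonym 'n pt = "(real^'n) \<times> (real^'n)"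

definition gph :: "('a \<Rightarrow> 'b set) \<Rightarrow> ('a \<times> 'b) set" where
  "gph F = {(x, y). y \<in> F x}"

definition locally_closed_around :: "'a::metric_space set \<Rightarrow> 'a \<Rightarrow> bool" where
  "locally_closed_around A z \<longleftrightarrow> (\<exists>r>0. closed (A \<inter> cball z r))"

definition tangent_cone :: "'a::real_normed_vector set \<Rightarrow> 'a \<Rightarrow> 'a set" where
  "tangent_cone A z = {w. \<exists>t ws. (\<forall>k. t k > 0) \<and> t \<longlonglongrightarrow> (0::real) \<and> ws \<longlonglongrightarrow> w \<and>
                          (\<forall>k::nat. z + t k *\<^sub>R ws k \<in> A)}"

definition orth_proj :: "'a::euclidean_space set \<Rightarrow> 'a \<Rightarrow> 'a" where
  "orth_proj L z = (THE p. p \<in> L \<and> z - p \<in> orthogonal_comp L)"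

definition Zn :: "('n::finite) pt set set" where
  "Zn = {L. subspace L \<and> dim L = CARD('n)}"

definition dZ :: "('n::finite) pt set \<Rightarrow> 'n pt set \<Rightarrow> real" where
  "dZ L1 L2 = onorm (\<lambda>z. orth_proj L1 z - orth_proj L2 z)"

definition adj :: "('n::finite) pt set \<Rightarrow> 'n pt set" where
  "adj L = {(- v, u) | u v. (u, v) \<in> orthogonal_comp L}"

definition rge :: "real^'n^'n \<Rightarrow> real^'n^'n \<Rightarrow> ('n::finite) pt set" where
  "rge B A = {(B *v p, A *v p) | p. True}"

definition Zn_reg :: "('n::finite) pt set set" where
  "Zn_reg = {L \<in> Zn. \<forall>y. (y, 0) \<in> L \<longrightarrow> y = 0}"

definition O_set :: "(real^'n \<Rightarrow> (real^'n) set) \<Rightarrow> ('n::finite) pt set" where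
  "O_set F = {z \<in> gph F. tangent_cone (gph F) z \<in> Zn}"

(* Only meant for z in gph F. *)
definition scd :: "(real^'n \<Rightarrow> (real^'n) set) \<Rightarrow> 'n pt \<Rightarrow> ('n::finite) pt set set" where
  "scd F z = {L \<in> Zn. \<exists>zs. (\<forall>k. zs k \<in> O_set F) \<and> zs \<longlonglongrightarrow> z \<and>
                 (\<lambda>k. dZ L (adj (tangent_cone (gph F) (zs k)))) \<longlonglongrightarrow> 0}"

definition scd_property :: "(real^'n \<Rightarrow> (real^'n) set) \<Rightarrow> ('n::finite) pt \<Rightarrow> bool" where
  "scd_property F z \<longleftrightarrow> (\<forall>\<^sub>F z' in nhds z. z' \<in> gph F \<longrightarrow> scd F z' \<noteq> {})"

definition scd_regular :: "(real^'n \<Rightarrow> (real^'n) set) \<Rightarrow> ('n::finite) pt \<Rightarrow> bool" where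
  "scd_regular F z \<longleftrightarrow> scd_property F z \<and> scd F z \<subseteq> Zn_reg"

(* By adj, the pairs (ys, xs) in a subspace of scd F z have the x-part second: they are limits of
   pairs for which (xs, - ys) is orthogonal to the tangent subspace. *)
definition scd_semismooth :: "(real^'n \<Rightarrow> (real^'n) set) \<Rightarrow> ('n::finite) pt \<Rightarrow> bool" where
  "scd_semismooth F zbar \<longleftrightarrow> scd_property F zbar \<and>
     (\<forall>\<epsilon>>0. \<exists>\<delta>>0. \<forall>z \<in> gph F \<inter> cball zbar \<delta>. \<forall>(ys, xs) \<in> \<Union> (scd F z).
        \<bar>xs \<bullet> (fst z - fst zbar) - ys \<bullet> (snd z - snd zbar)\<bar>
          \<le> \<epsilon> * norm (z - zbar) * norm (xs, ys))"

definition newton_approx ::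
    "(real^'n \<Rightarrow> (real^'n) set) \<Rightarrow> real^'n \<Rightarrow> real \<Rightarrow> real^'n \<Rightarrow> ('n::finite) pt \<Rightarrow> bool" where
  "newton_approx F xbar \<eta> x z \<longleftrightarrow>
     z \<in> gph F \<and> norm (z - (xbar, 0)) \<le> \<eta> * norm (x - xbar)"

definition newton_step :: "'n pt \<Rightarrow> ('n::finite) pt set \<Rightarrow> real^'n \<Rightarrow> bool" where
  "newton_step z L x' \<longleftrightarrow>
     (\<exists>A B \<Delta>. L = rge (transpose B) (transpose A) \<and> A *v \<Delta> = - (B *v snd z) \<and> x' = fst z + \<Delta>)"

definition newton_iteration ::
    "(real^'n \<Rightarrow> (real^'n) set) \<Rightarrow> real^'n \<Rightarrow> real \<Rightarrow> real^'n \<Rightarrow> real^('n::finite) \<Rightarrow> bool" where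
  "newton_iteration F xbar \<eta> x x' \<longleftrightarrow> 0 \<notin> F x \<and>
     (\<exists>z. newton_approx F xbar \<eta> x z \<and> (\<exists>L \<in> scd F z \<inter> Zn_reg. newton_step z L x'))"

(* The approximation step and the Newton step can be carried out at every non-solution that
   the method can generate from x0, whatever choices were made before. *)
definition newton_well_defined ::
    "(real^'n \<Rightarrow> (real^'n) set) \<Rightarrow> real^'n \<Rightarrow> real \<Rightarrow> real^('n::finite) \<Rightarrow> bool" where
  "newton_well_defined F xbar \<eta> x0 \<longleftrightarrow>
     (\<forall>x. (newton_iteration F xbar \<eta>)\<^sup>*\<^sup>* x0 x \<and> 0 \<notin> F x \<longrightarrow>
        (\<exists>z. newton_approx F xbar \<eta> x z \<and> scd F z \<inter> Zn_reg \<noteq> {}) \<and>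
        (\<forall>z. newton_approx F xbar \<eta> x z \<and> scd F z \<inter> Zn_reg \<noteq> {} \<longrightarrow>
           (\<exists>A B. rge (transpose B) (transpose A) \<in> scd F z \<inter> Zn_reg) \<and>
           (\<forall>A B. rge (transpose B) (transpose A) \<in> scd F z \<inter> Zn_reg \<longrightarrow>
              (\<exists>!\<Delta>. A *v \<Delta> = - (B *v snd z)))))"

(* Every pair z satisfying only the distance bound, and every L in scd F z, is an admissible
   choice for the method; no separate check of regularity is needed. *)
definition newton_all_choices_admissible ::
    "(real^'n \<Rightarrow> (real^'n) set) \<Rightarrow> real^'n \<Rightarrow> real \<Rightarrow> real^('n::finite) \<Rightarrow> bool" where
  "newton_all_choices_admissible F xbar \<eta> x0 \<longleftrightarrow>
     (\<forall>x. (newton_iteration F xbar \<eta>)\<^sup>*\<^sup>* x0 x \<and> 0 \<notin> F x \<longrightarrow>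
        (\<forall>z. newton_approx F xbar \<eta> x z \<longrightarrow>
           scd F z \<noteq> {} \<and> (\<forall>L \<in> scd F z. L \<in> Zn_reg \<and> (\<exists>x'. newton_step z L x'))))"

definition superlinearly_convergent :: "(nat \<Rightarrow> 'a::real_normed_vector) \<Rightarrow> 'a \<Rightarrow> bool" where
  "superlinearly_convergent x xbar \<longleftrightarrow> x \<longlonglongrightarrow> xbar \<and>
     (\<lambda>k. norm (x (Suc k) - xbar)) \<in> o(\<lambda>k. norm (x k - xbar))"

(* A run of the method with arbitrary choices z k and L k. It obeys the rules of the method as
   long as no solution has been reached; the entries after stopping are irrelevant. *)
definition newton_run ::
    "(real^'n \<Rightarrow> (real^'n) set) \<Rightarrow> real^'n \<Rightarrow> real \<Rightarrow> (nat \<Rightarrow> real^'n) \<Rightarrow> (nat \<Rightarrow> 'n pt)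
       \<Rightarrow> (nat \<Rightarrow> ('n::finite) pt set) \<Rightarrow> bool" where
  "newton_run F xbar \<eta> x z L \<longleftrightarrow>
     (\<forall>k. (\<forall>j\<le>k. 0 \<notin> F (x j)) \<longrightarrow>
        newton_approx F xbar \<eta> (x k) (z k) \<and> L k \<in> scd F (z k) \<and>
        newton_step (z k) (L k) (x (Suc k)))"

end

(* Let A, B represent the chosen subspace L = rge(B^T, A^T), so that A (x' - xbar) =
   A (xhat - xbar) - B yhat for the new iterate x'. Testing the semismoothness inequality with the
   pair (B^T p, A^T p) for which A^T p = x' - xbar gives
   |x' - xbar|^2 <= eps |(xhat, yhat) - (xbar, 0)| |(A^T p, B^T p)|, and this is at most a multiple of
   eps |x - xbar| |x' - xbar| as soon as the matrices C_L are uniformly bounded near (xbar, 0).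
   Such a bound follows by contradiction: orthogonal projections onto n-dimensional subspaces form a
   compact set and z |-> S*F(z) has closed graph, so unbounded C_L would produce a nonregular
   subspace in S*F(xbar, 0). Solvability of the approximation step is trivial: (xbar, 0) itself
   is admissible. *)

theory Submission
  imports Defs
begin

section \<open>Orthogonal projections onto subspaces\<close>

text \<open>Two candidates differ by a vector in both \<open>L\<close> and its orthogonal
  complement, hence orthogonal to itself; existence is the orthogonal decomposition of
  \<open>z\<close>. Later values of \<open>orth_proj\<close>, defined by \<open>THE\<close>, are
  identified through these two conditions.\<close>

lemma orth_proj_eq_iff:
  fixes L :: "'a::euclidean_space set"
  assumes "subspace L"
  shows "orth_proj L z = p \<longleftrightarrow> p \<in> L \<and> z - p \<in> orthogonal_comp L"
proof -
  obtain v w where vw: "z = v + w" "v \<in> L" "w \<in> orthogonal_comp L"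
    using subspace_sum_orthogonal_comp[OF assms] set_plus_elim by (metis UNIV_I)
  have "q = v" if "q \<in> L" "z - q \<in> orthogonal_comp L" for q
  proof -
    have "(z - q) - w \<in> orthogonal_comp L"
      using that(2) vw(3) by (rule subspace_diff[OF subspace_orthogonal_comp])
    then have "v - q \<in> orthogonal_comp L"
      by (simp add: vw(1))
    moreover have "v - q \<in> L"
      using assms that vw by (simp add: subspace_diff)
    ultimately have "orthogonal (v - q) (v - q)"
      by (auto simp: orthogonal_comp_def)
    then show ?thesis by (simp add: orthogonal_self)
  qed
  then have "\<exists>!p. p \<in> L \<and> z - p \<in> orthogonal_comp L"
    using vw by (intro ex1I[of _ v]) auto
  then show ?thesis
    unfolding orth_proj_def by (metis (mono_tags, lifting) theI')
qed

lemma
  assumes "subspace L"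
  shows orth_proj_in: "orth_proj L z \<in> L"
    and orth_proj_orthogonal: "z - orth_proj L z \<in> orthogonal_comp L"
    and orth_proj_fixed_iff: "orth_proj L z = z \<longleftrightarrow> z \<in> L"
  using orth_proj_eq_iff[OF assms] subspace_0[OF subspace_orthogonal_comp[of L]] by auto

lemma linear_orth_proj: "linear (orth_proj L)" if L: "subspace L"
proof (rule linearI)
  fix x y and c :: real
  have "(x - orth_proj L x) + (y - orth_proj L y) \<in> orthogonal_comp L"
    by (intro subspace_add subspace_orthogonal_comp orth_proj_orthogonal L)
  then show "orth_proj L (x + y) = orth_proj L x + orth_proj L y"
    by (simp add: orth_proj_eq_iff L orth_proj_in subspace_add algebra_simps)
  have "c *\<^sub>R (x - orth_proj L x) \<in> orthogonal_comp L"
    by (intro subspace_mul subspace_orthogonal_comp orth_proj_orthogonal L)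
  then show "orth_proj L (c *\<^sub>R x) = c *\<^sub>R orth_proj L x"
    by (simp add: orth_proj_eq_iff L orth_proj_in subspace_mul algebra_simps)
qed

text \<open>Both sides equal the inner product of the two projections.\<close>

lemma orth_proj_self_adjoint: "orth_proj L x \<bullet> y = x \<bullet> orth_proj L y" if L: "subspace L"
proof -
  have "orthogonal (orth_proj L x) (y - orth_proj L y)"
    and "orthogonal (orth_proj L y) (x - orth_proj L x)"
    using orth_proj_in[OF L] orth_proj_orthogonal[OF L] by (auto simp: orthogonal_comp_def)
  then show ?thesis
    by (simp add: orthogonal_def inner_diff_right inner_commute)
qed

lemma norm_orth_proj_le: "norm (orth_proj L z) \<le> norm z" if L: "subspace L"
proof -
  have "norm (orth_proj L z) ^ 2 = z \<bullet> orth_proj L z"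
    using orth_proj_self_adjoint[OF L, of z "orth_proj L z"] orth_proj_in[OF L, of z]
      orth_proj_fixed_iff[OF L, of "orth_proj L z"]
    by (simp add: power2_norm_eq_inner)
  also have "\<dots> \<le> norm z * norm (orth_proj L z)"
    by (rule norm_cauchy_schwarz)
  finally show ?thesis
    by (cases "orth_proj L z = 0") (auto simp: power2_eq_square)
qed

text \<open>As elements of a finite-dimensional normed space of operators, projections admit
  convergent subsequences, and \<open>dZ\<close> becomes the ordinary distance.
  \<open>Blinfun\<close> is meaningful here because \<open>orth_proj L\<close> is bounded linear for
  a subspace \<open>L\<close>.\<close>

definition proj_blinfun :: "'a::euclidean_space set \<Rightarrow> 'a \<Rightarrow>\<^sub>L 'a"
  where "proj_blinfun L = Blinfun (orth_proj L)"

lemma proj_blinfun_apply [simp]: "subspace L \<Longrightarrow> blinfun_apply (proj_blinfun L) = orth_proj L"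
  unfolding proj_blinfun_def
  by (intro bounded_linear_Blinfun_apply linear_conv_bounded_linear[THEN iffD1] linear_orth_proj)

lemma norm_proj_blinfun_le: "subspace L \<Longrightarrow> norm (proj_blinfun L) \<le> 1"
  by (rule norm_blinfun_bound) (auto simp: norm_orth_proj_le)

lemma dZ_eq_dist: "dZ L1 L2 = dist (proj_blinfun L1) (proj_blinfun L2)"
  if "subspace L1" "subspace L2"
proof -
  have "blinfun_apply (proj_blinfun L1 - proj_blinfun L2) = (\<lambda>z. orth_proj L1 z - orth_proj L2 z)"
    using that by (auto simp: blinfun.diff_left)
  then show ?thesis
    by (simp add: dZ_def dist_norm norm_blinfun.rep_eq)
qed

text \<open>Image of an orthogonal complement under a linear map. It makes \<open>dZ_eq_dist\<close>
  applicable to adjoints of tangent cones.\<close>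

lemma subspace_adj: "subspace (adj L)"
proof -
  have "linear (\<lambda>(u, v). (- v, u) :: 'a pt)"
    by (rule linearI) auto
  moreover have "adj L = (\<lambda>(u, v). (- v, u)) ` orthogonal_comp L"
    by (auto simp: adj_def)
  ultimately show ?thesis
    by (simp add: linear_subspace_image subspace_orthogonal_comp)
qed

lemma Zn_subspace: "L \<in> Zn \<Longrightarrow> subspace L"
  by (simp add: Zn_def)

section \<open>Limits in the projection metric and the resulting uniform bound\<close>

text \<open>The projection onto \<open>M\<close> is injective on \<open>L\<close>: a nonzero
  \<open>x\<close> in \<open>L\<close> that it kills would be moved by the difference of the
  projections to a vector of full norm. By symmetry the dimension is locally constant.\<close>

lemma dim_le_of_proj_blinfun_close:
  fixes L M :: "'a::euclidean_space set"
  assumes "subspace L" "subspace M" "dist (proj_blinfun L) (proj_blinfun M) < 1"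
  shows "dim L \<le> dim M"
proof -
  have "inj_on (orth_proj M) (span L)"
  proof (rule linear_injective_on_subspace_0[OF linear_orth_proj[OF assms(2)] subspace_span, THEN iffD2], safe)
    fix x assume "x \<in> span L" "orth_proj M x = 0"
    then have "x \<in> L" using assms by (metis span_eq_iff)
    have "norm x = norm ((proj_blinfun L - proj_blinfun M) x)"
      using assms \<open>x \<in> L\<close> \<open>orth_proj M x = 0\<close> orth_proj_fixed_iff[OF assms(1), of x]
      by (simp add: blinfun.diff_left)
    also have "\<dots> \<le> dist (proj_blinfun L) (proj_blinfun M) * norm x"
      unfolding dist_norm by (rule norm_blinfun)
    finally show "x = 0"
      using assms(3) by (metis mult_le_cancel_right1 norm_le_zero_iff not_less)
  qed
  then have "dim L = dim (orth_proj M ` L)"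
    using dim_image_eq[OF linear_orth_proj[OF assms(2)]] by metis
  also have "\<dots> \<le> dim M"
    by (intro dim_subset) (auto simp: orth_proj_in assms)
  finally show ?thesis .
qed

text \<open>Self-adjointness and idempotence pass to the limit, so \<open>P\<close> is the
  orthogonal projection onto its range; local constancy of the dimension does the rest. With the
  norm bound 1 this yields compactness of \<open>Zn\<close>.\<close>

lemma Zn_closed:
  assumes Ls: "\<And>k. Ls k \<in> Zn" and lim: "(\<lambda>k. proj_blinfun (Ls k)) \<longlonglongrightarrow> P"
  obtains L where "L \<in> Zn" "proj_blinfun L = P"
proof -
  define L where "L = range (blinfun_apply P)"
  note sub = Zn_subspace[OF Ls]
  have lim': "(\<lambda>k. orth_proj (Ls k) x) \<longlonglongrightarrow> P x" for x
    using blinfun.tendsto[OF lim tendsto_const[of x]] by (simp add: sub)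
  have self: "P x \<bullet> y = x \<bullet> P y" for x y
    by (rule LIMSEQ_unique[OF tendsto_inner[OF lim' tendsto_const]])
      (use tendsto_inner[OF tendsto_const lim', of x y] in \<open>simp add: orth_proj_self_adjoint sub\<close>)
  have idem: "P (P x) = P x" for x
  proof (rule LIMSEQ_unique[OF _ lim'])
    have "orth_proj (Ls k) (orth_proj (Ls k) x) = orth_proj (Ls k) x" for k
      by (simp add: orth_proj_fixed_iff orth_proj_in sub)
    then show "(\<lambda>k. orth_proj (Ls k) x) \<longlonglongrightarrow> P (P x)"
      using blinfun.tendsto[OF lim lim', of x] by (simp add: sub)
  qed
  have L: "subspace L"
    unfolding L_def by (intro linear_subspace_image subspace_UNIV bounded_linear.linear blinfun.bounded_linear_right)
  \<comment> \<open>The residual \<open>x - P x\<close> is orthogonal to each \<open>P y\<close>: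
    moving \<open>P\<close> across the inner product leaves
    \<open>P x - P (P x) = 0\<close>.\<close>
  have "orth_proj L x = P x" for x
    unfolding orth_proj_eq_iff[OF L]
    by (auto simp: L_def orthogonal_comp_def orthogonal_def blinfun.diff_right self idem)
  then have P: "proj_blinfun L = P"
    by (intro blinfun_eqI) (simp add: L)
  obtain k where "dist (proj_blinfun (Ls k)) (proj_blinfun L) < 1"
    using tendstoD[OF lim, of 1] P by (auto simp: eventually_sequentially)
  then have "dim L = dim (Ls k)"
    by (intro antisym dim_le_of_proj_blinfun_close L sub) (auto simp: dist_commute)
  then have "L \<in> Zn"
    using L Ls[of k] by (simp add: Zn_def)
  with P show thesis by (rule that[rotated])
qed

text \<open>Diagonal argument: a single point of \<open>O_set F\<close> is chosen for each
  \<open>k\<close>, close to \<open>zs k\<close> and with adjoint tangent subspace close to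
  \<open>Ls k\<close>. The triangle inequality through \<open>Ls k\<close> then gives convergence to
  \<open>L\<close>.\<close>

lemma scd_closed:
  assumes Ls: "\<And>k. Ls k \<in> scd F (zs k)" and zs: "zs \<longlonglongrightarrow> z"
    and L: "L \<in> Zn" "(\<lambda>k. proj_blinfun (Ls k)) \<longlonglongrightarrow> proj_blinfun L"
  shows "L \<in> scd F z"
proof -
  define \<tau> where "\<tau> w = adj (tangent_cone (gph F) w)" for w
  have "\<exists>w. w \<in> O_set F \<and> dist w (zs k) < inverse (Suc k) \<and> dZ (Ls k) (\<tau> w) < inverse (Suc k)" for k
  proof -
    obtain ws where ws: "\<And>j. ws j \<in> O_set F" "ws \<longlonglongrightarrow> zs k" "(\<lambda>j. dZ (Ls k) (\<tau> (ws j))) \<longlonglongrightarrow> 0"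
      using Ls[of k] by (auto simp: scd_def \<tau>_def)
    have "\<forall>\<^sub>F j in sequentially. dist (ws j) (zs k) < inverse (Suc k) \<and> dZ (Ls k) (\<tau> (ws j)) < inverse (Suc k)"
      by (intro eventually_conj tendstoD[OF ws(2)] order_tendstoD(2)[OF ws(3)]) auto
    then show ?thesis
      using ws(1) eventually_happens'[OF sequentially_bot] by blast
  qed
  then obtain w where w: "\<And>k. w k \<in> O_set F" "\<And>k. dist (w k) (zs k) < inverse (Suc k)"
    "\<And>k. dZ (Ls k) (\<tau> (w k)) < inverse (Suc k)"
    by metis
  have sub: "subspace (Ls k)" for k
    using Ls by (auto simp: scd_def Zn_def)
  have "w \<longlonglongrightarrow> z"
  proof (rule Lim_transform[OF zs])
    show "(\<lambda>k. w k - zs k) \<longlonglongrightarrow> 0"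
      by (rule Lim_null_comparison[OF _ LIMSEQ_inverse_real_of_nat])
        (use w(2) in \<open>auto simp: dist_norm intro!: always_eventually less_imp_le\<close>)
  qed
  moreover have "(\<lambda>k. dZ L (\<tau> (w k))) \<longlonglongrightarrow> 0"
  proof (rule Lim_null_comparison)
    show "(\<lambda>k. dist (proj_blinfun (Ls k)) (proj_blinfun L) + inverse (Suc k)) \<longlonglongrightarrow> 0"
      using tendsto_add[OF tendsto_dist[OF L(2) tendsto_const[of "proj_blinfun L"]] LIMSEQ_inverse_real_of_nat]
      by simp
    show "\<forall>\<^sub>F k in sequentially. norm (dZ L (\<tau> (w k)))
            \<le> dist (proj_blinfun (Ls k)) (proj_blinfun L) + inverse (Suc k)"
    proof (rule always_eventually, rule allI)
      fix k
      show "norm (dZ L (\<tau> (w k))) \<le> dist (proj_blinfun (Ls k)) (proj_blinfun L) + inverse (Suc k)"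
        using w(3)[of k] dist_triangle3[of "proj_blinfun L" "proj_blinfun (\<tau> (w k))" "proj_blinfun (Ls k)"]
        by (simp add: dZ_eq_dist sub Zn_subspace[OF L(1)] subspace_adj \<tau>_def)
    qed
  qed
  ultimately show ?thesis
    using L(1) w(1) by (auto simp: scd_def \<tau>_def)
qed

text \<open>The constant bounds the operator norms of the matrices \<open>C\<^sub>L\<close> uniformly in \<open>L\<close>.\<close>
lemma scd_uniform_bound:
  fixes F :: "real^'n \<Rightarrow> (real^'n::finite) set"
  assumes reg: "scd F z \<subseteq> Zn_reg"
  obtains \<kappa> \<delta> where "\<kappa> > 0" "\<delta> > 0"
    "\<And>z' L y x. dist z' z < \<delta> \<Longrightarrow> L \<in> scd F z' \<Longrightarrow> (y, x) \<in> L \<Longrightarrow> norm y \<le> \<kappa> * norm x"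
proof (rule ccontr)
  assume neg: "\<not> thesis"
  \<comment> \<open>Failure of the bound with constant \<open>Suc k\<close> and radius
    \<open>inverse (Suc k)\<close> supplies one counterexample for each \<open>k\<close>.\<close>
  have "\<exists>w L y x. dist w z < inverse (Suc k) \<and> L \<in> scd F w \<and> (y, x) \<in> L \<and> norm y > Suc k * norm x" for k
  proof (rule ccontr)
    assume "\<not> ?thesis"
    then have "thesis"
      by (intro that[of "Suc k" "inverse (Suc k)"]) (force simp: not_less simp del: of_nat_Suc split_paired_All split_paired_Ex)+
    then show False using neg by simp
  qed
  then obtain zs Ls y x where zs: "\<And>k. dist (zs k) z < inverse (Suc k)"
    and Ls: "\<And>k. Ls k \<in> scd F (zs k)" and yx: "\<And>k. (y k, x k) \<in> Ls k"
    and big: "\<And>k. norm (y k) > Suc k * norm (x k)"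
    by metis
  have Zn: "Ls k \<in> Zn" for k
    using Ls by (auto simp: scd_def)
  note sub = Zn_subspace[OF Zn]
  have pos: "norm (y k) > 0" for k
    using big[of k] by (meson le_less_trans mult_nonneg_nonneg norm_ge_zero of_nat_0_le_iff)
  \<comment> \<open>Scaling the first component to norm 1 keeps the pair in the subspace and forces
    the second component to 0.\<close>
  define u v where "u k = y k /\<^sub>R norm (y k)" and "v k = x k /\<^sub>R norm (y k)" for k
  have uv: "(u k, v k) \<in> Ls k" for k
    using subspace_mul[OF sub yx, of "inverse (norm (y k))" k] by (simp add: u_def v_def)
  have u: "norm (u k) = 1" for k
    using pos[of k] by (simp add: u_def)
  have v: "norm (v k) \<le> inverse (Suc k)" for k
    using big[of k] pos[of k] by (simp add: v_def field_simps)
  \<comment> \<open>Pairing operators with unit vectors gives one subsequence along which both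
    converge.\<close>
  have "bounded (range (\<lambda>k. (proj_blinfun (Ls k), u k)))"
    by (rule bounded_subset[OF bounded_Times[OF bounded_cball bounded_cball], of _ 0 1 0 1])
      (auto simp: u norm_proj_blinfun_le sub)
  from bounded_imp_convergent_subsequence[OF this] obtain P u' r where r: "strict_mono r"
    and lim: "(\<lambda>k. (proj_blinfun (Ls (r k)), u (r k))) \<longlonglongrightarrow> (P, u')"
    by (auto simp: o_def)
  have limP: "(\<lambda>k. proj_blinfun (Ls (r k))) \<longlonglongrightarrow> P" and limu: "(\<lambda>k. u (r k)) \<longlonglongrightarrow> u'"
    using tendsto_fst[OF lim] tendsto_snd[OF lim] by simp_all
  obtain L where L: "L \<in> Zn" "proj_blinfun L = P"
    using Zn_closed[OF Zn limP] by blast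
  have "zs \<longlonglongrightarrow> z"
    by (rule metric_tendsto_imp_tendsto[OF LIMSEQ_inverse_real_of_nat])
      (use zs in \<open>auto intro!: always_eventually less_imp_le\<close>)
  then have "(\<lambda>k. zs (r k)) \<longlonglongrightarrow> z"
    using LIMSEQ_subseq_LIMSEQ[OF _ r] by (simp add: o_def)
  then have "L \<in> scd F z"
    by (rule scd_closed[OF Ls _ L(1) limP[folded L(2)]])
  moreover have "(u', 0) \<in> L"
  proof -
    have "v \<longlonglongrightarrow> 0"
      by (rule Lim_null_comparison[OF always_eventually LIMSEQ_inverse_real_of_nat]) (use v in blast)
    then have "(\<lambda>k. v (r k)) \<longlonglongrightarrow> 0"
      using LIMSEQ_subseq_LIMSEQ[OF _ r] by (auto simp: o_def)
    then have uvlim: "(\<lambda>k. (u (r k), v (r k))) \<longlonglongrightarrow> (u', 0)"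
      by (intro tendsto_Pair limu)
    \<comment> \<open>Membership is written as a fixed-point equation of the projection, which
      survives the limit.\<close>
    have "orth_proj (Ls (r k)) (u (r k), v (r k)) = (u (r k), v (r k))" for k
      by (simp add: orth_proj_fixed_iff sub uv)
    then have "(\<lambda>k. (u (r k), v (r k))) \<longlonglongrightarrow> P (u', 0)"
      using blinfun.tendsto[OF limP uvlim] by (simp add: sub)
    then have "P (u', 0) = (u', 0)"
      using uvlim LIMSEQ_unique by blast
    then show ?thesis
      using L orth_proj_fixed_iff[of L "(u', 0)"] Zn_subspace[OF L(1)] by auto
  qed
  ultimately have "u' = 0"
    using reg by (auto simp: Zn_reg_def)
  then show False
    using LIMSEQ_unique[OF tendsto_norm[OF limu], of 1] by (simp add: u)
qed

section \<open>Regular subspaces and solvability of the Newton equation\<close>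

lemma Zn_reg_snd_inj: "inj_on snd L" if "L \<in> Zn_reg"
proof (rule inj_onI)
  fix p q assume pq: "p \<in> L" "q \<in> L" "snd p = snd q"
  then have "p - q \<in> L"
    using that by (simp add: Zn_reg_def Zn_def subspace_diff)
  moreover have "p - q = (fst p - fst q, 0)"
    using pq(3) by (simp add: prod_eq_iff)
  ultimately show "p = q"
    using that pq(3) by (auto simp: Zn_reg_def prod_eq_iff)
qed

text \<open>An injective linear map from an n-dimensional subspace into R^n is onto. So
  \<open>snd\<close> is a bijection on \<open>L\<close>, and its inverse has first component
  C_L.\<close>

lemma Zn_reg_snd_surj: "snd ` L = UNIV" if L: "L \<in> Zn_reg" for L :: "('n::finite) pt set"
proof -
  have "subspace L" "dim L = CARD('n)"
    using L by (auto simp: Zn_reg_def Zn_def)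
  moreover from this have "span L = L"
    by simp
  ultimately have "dim (snd ` L) = DIM(real^'n)"
    using dim_image_eq[OF linear_snd, of L] Zn_reg_snd_inj[OF L] by (simp only: DIM_cart DIM_real mult_1_right)
  then have "span (snd ` L) = UNIV"
    by (metis dim_eq_full)
  then show ?thesis
    using \<open>span L = L\<close> span_linear_image[OF linear_snd, of L] by simp
qed

text \<open>A linear left inverse \<open>g\<close> of \<open>snd\<close> on \<open>L\<close>
  parametrises \<open>L\<close>; the matrices of its two components, here C_L and the identity, give
  the representation.\<close>

lemma Zn_reg_rge_cases:
  assumes L: "L \<in> Zn_reg"
  obtains A B where "L = rge (transpose B) (transpose A)"
proof -
  obtain g where g: "range g \<subseteq> L" "linear g" "\<And>v. v \<in> L \<Longrightarrow> g (snd v) = v"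
    using linear_exists_left_inverse_on[OF linear_snd _ Zn_reg_snd_inj[OF L]] L
    by (auto simp: Zn_reg_def Zn_def)
  have lin: "linear (fst \<circ> g)" "linear (snd \<circ> g)"
    by (intro linear_compose g(2) linear_fst linear_snd)+
  have "L \<subseteq> range g"
    by (metis g(3) rangeI subsetI)
  with g(1) have "L = range g"
    by simp
  also have "\<dots> = rge (matrix (fst \<circ> g)) (matrix (snd \<circ> g))"
    using matrix_vector_mul(2)[OF lin(1)] matrix_vector_mul(2)[OF lin(2)]
    by (auto simp: rge_def)
  finally show thesis
    by (intro that[of "transpose (matrix (fst \<circ> g))" "transpose (matrix (snd \<circ> g))"]) simp
qed

text \<open>Surjectivity of \<open>snd\<close> on the subspace is surjectivity of
  \<open>transpose A\<close>.\<close>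

lemma invertible_of_rge_in_Zn_reg: "invertible A" if "rge (transpose B) (transpose A) \<in> Zn_reg"
proof -
  have "snd ` rge (transpose B) (transpose A) = range ((*v) (transpose A))"
    by (force simp: rge_def)
  then have "surj ((*v) (transpose A))"
    using Zn_reg_snd_surj[OF that] by simp
  then show ?thesis
    by (metis invertible_left_inverse matrix_right_invertible_surjective right_invertible_transpose)
qed

lemma invertible_ex1_solution: "\<exists>!x. A *v x = b" if "invertible A" for A :: "real^'n^'n"
  using that
  by (metis invertible_def matrix_vector_mul_assoc matrix_vector_mul_lid)

lemma newton_step_exists: "\<exists>x'. newton_step z L x'" if L: "L \<in> Zn_reg"
proof -
  obtain A B where AB: "L = rge (transpose B) (transpose A)"
    using Zn_reg_rge_cases[OF L] .
  then have "\<exists>!\<Delta>. A *v \<Delta> = - (B *v snd z)"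
    using L by (intro invertible_ex1_solution invertible_of_rge_in_Zn_reg[of B]) simp
  then show ?thesis
    using AB unfolding newton_step_def by blast
qed

section \<open>Error of one Newton step\<close>

lemma newton_step_error:
  assumes step: "newton_step z L x'" and L: "L \<in> Zn_reg"
    and bound: "\<And>ys xs. (ys, xs) \<in> L \<Longrightarrow> norm ys \<le> \<kappa> * norm xs"
    and semi: "\<And>ys xs. (ys, xs) \<in> L \<Longrightarrow>
      \<bar>xs \<bullet> (fst z - xbar) - ys \<bullet> snd z\<bar> \<le> \<epsilon> * norm (z - (xbar, 0)) * norm (xs, ys)"
    and nonneg: "\<epsilon> \<ge> 0" "\<kappa> \<ge> 0"
  shows "norm (x' - xbar) \<le> \<epsilon> * (1 + \<kappa>) * norm (z - (xbar, 0))"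
\<comment> \<open>The final step cancels a factor \<open>norm (x' - xbar)\<close>.\<close>
proof (cases "x' = xbar")
  case True
  with nonneg show ?thesis by simp
next
  case False
  from step obtain A B \<Delta> where AB: "L = rge (transpose B) (transpose A)"
    and \<Delta>: "A *v \<Delta> = - (B *v snd z)" and x': "x' = fst z + \<Delta>"
    by (auto simp: newton_step_def)
  define u where "u = x' - xbar"
  \<comment> \<open>The test pair has the new error \<open>u\<close> as its x-part.\<close>
  obtain y where "(y, u) \<in> L"
    using Zn_reg_snd_surj[OF L] by (metis UNIV_I imageE prod.collapse)
  then obtain p where p: "y = transpose B *v p" "u = transpose A *v p"
    by (auto simp: AB rge_def)
  \<comment> \<open>Moving the transposes off \<open>p\<close> produces
    \<open>- (B *v snd z)\<close>, which the Newton equation turns into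
    \<open>A *v \<Delta>\<close>.\<close>
  have "u \<bullet> (fst z - xbar) - y \<bullet> snd z = p \<bullet> (A *v (fst z - xbar) + A *v \<Delta>)"
    by (simp add: p \<Delta> dot_lmul_matrix inner_diff_right matrix_vector_mult_diff_distrib)
  also have "\<dots> = p \<bullet> (A *v u)"
    by (simp only: u_def x' matrix_vector_right_distrib[symmetric] diff_add_eq)
  also have "\<dots> = norm u ^ 2"
    by (simp only: dot_lmul_matrix[symmetric] transpose_matrix_vector[symmetric] p(2)[symmetric] power2_norm_eq_inner)
  finally have "norm u ^ 2 \<le> \<epsilon> * norm (z - (xbar, 0)) * norm (u, y)"
    using semi[OF \<open>(y, u) \<in> L\<close>] by simp
  also have "\<dots> \<le> \<epsilon> * norm (z - (xbar, 0)) * ((1 + \<kappa>) * norm u)"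
    using bound[OF \<open>(y, u) \<in> L\<close>] norm_Pair_le[of u y] nonneg(1)
    by (intro mult_left_mono) (auto simp: algebra_simps)
  finally have "norm u * norm u \<le> (\<epsilon> * (1 + \<kappa>) * norm (z - (xbar, 0))) * norm u"
    by (simp add: power2_eq_square mult_ac)
  then show ?thesis
    using False by (simp add: u_def)
qed

section \<open>Local contraction and superlinear rate\<close>

text \<open>The factor 1/2 gives convergence; the iterates then eventually enter the ball belonging
  to any prescribed \<open>c\<close>, where the ratio is at most \<open>c\<close>.\<close>

lemma superlinearly_convergentI:
  assumes contr: "\<And>k. norm (x (Suc k) - a) \<le> 1 / 2 * norm (x k - a)"
    and small: "\<And>c. c > 0 \<Longrightarrow> \<exists>\<delta>>0. \<forall>k. dist (x k) a < \<delta> \<longrightarrow> norm (x (Suc k) - a) \<le> c * norm (x k - a)"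
  shows "superlinearly_convergent x a"
proof -
  have "norm (x k - a) \<le> (1 / 2) ^ k * norm (x 0 - a)" for k
  proof (induction k)
    case (Suc k)
    with contr[of k] show ?case by simp
  qed simp
  moreover have "(\<lambda>k. (1 / 2) ^ k * norm (x 0 - a)) \<longlonglongrightarrow> 0"
    by (intro tendsto_mult_left_zero LIMSEQ_realpow_zero) auto
  ultimately have "(\<lambda>k. x k - a) \<longlonglongrightarrow> 0"
    by (intro Lim_null_comparison[OF always_eventually, of "\<lambda>k. x k - a" "\<lambda>k. (1 / 2) ^ k * norm (x 0 - a)"]) blast+
  then have lim: "x \<longlonglongrightarrow> a"
    by (rule LIM_zero_cancel)
  have "(\<lambda>k. norm (x (Suc k) - a)) \<in> o(\<lambda>k. norm (x k - a))"
  proof (rule landau_o.smallI)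
    fix c :: real assume "c > 0"
    then obtain \<delta> where "\<delta> > 0" "\<And>k. dist (x k) a < \<delta> \<Longrightarrow> norm (x (Suc k) - a) \<le> c * norm (x k - a)"
      using small by blast
    then show "\<forall>\<^sub>F k in sequentially. norm (norm (x (Suc k) - a)) \<le> c * norm (norm (x k - a))"
      using tendstoD[OF lim \<open>\<delta> > 0\<close>] by (auto elim!: eventually_mono)
  qed
  with lim show ?thesis
    by (simp add: superlinearly_convergent_def)
qed

text \<open>The factor \<open>c\<close> is free: 1/2 serves to fix the neighborhood, and arbitrarily
  small values give the superlinear rate.\<close>

lemma newton_contraction:
  fixes F :: "real^'n \<Rightarrow> (real^'n::finite) set"
  assumes semi: "scd_semismooth F (xbar, 0)" and reg: "scd F (xbar, 0) \<subseteq> Zn_reg"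
    and "\<eta> > 0" "c > 0"
  obtains \<delta> where "\<delta> > 0"
    "\<And>x z L. dist x xbar < \<delta> \<Longrightarrow> newton_approx F xbar \<eta> x z \<Longrightarrow> L \<in> scd F z \<Longrightarrow> L \<in> Zn_reg"
    "\<And>x z L x'. dist x xbar < \<delta> \<Longrightarrow> newton_approx F xbar \<eta> x z \<Longrightarrow> L \<in> scd F z \<Longrightarrow> newton_step z L x'
       \<Longrightarrow> norm (x' - xbar) \<le> c * norm (x - xbar)"
proof -
  obtain \<kappa> \<delta>1 where \<kappa>: "\<kappa> > 0" "\<delta>1 > 0"
    "\<And>z' L y x. dist z' (xbar, 0) < \<delta>1 \<Longrightarrow> L \<in> scd F z' \<Longrightarrow> (y, x) \<in> L \<Longrightarrow> norm y \<le> \<kappa> * norm x"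
    using scd_uniform_bound[OF reg] by blast
  \<comment> \<open>Chosen so that \<open>\<epsilon> * (1 + \<kappa>) * \<eta> = c\<close>.\<close>
  define \<epsilon> where "\<epsilon> = c / ((1 + \<kappa>) * \<eta>)"
  have "\<epsilon> > 0"
    using assms \<kappa> by (simp add: \<epsilon>_def)
  obtain \<delta>2 where \<delta>2: "\<delta>2 > 0" "\<And>z L ys xs. z \<in> gph F \<Longrightarrow> dist z (xbar, 0) \<le> \<delta>2 \<Longrightarrow> L \<in> scd F z \<Longrightarrow>
      (ys, xs) \<in> L \<Longrightarrow> \<bar>xs \<bullet> (fst z - xbar) - ys \<bullet> snd z\<bar> \<le> \<epsilon> * norm (z - (xbar, 0)) * norm (xs, ys)"
  proof -
    from semi \<open>\<epsilon> > 0\<close> obtain d where "d > 0" and d: "\<forall>z \<in> gph F \<inter> cball (xbar, 0) d. \<forall>(ys, xs) \<in> \<Union> (scd F z).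
        \<bar>xs \<bullet> (fst z - xbar) - ys \<bullet> snd z\<bar> \<le> \<epsilon> * norm (z - (xbar, 0)) * norm (xs, ys)"
      by (auto simp only: scd_semismooth_def fst_conv snd_conv diff_zero)
    show thesis
    proof (rule that[OF \<open>d > 0\<close>])
      fix z L ys xs
      assume "z \<in> gph F" "dist z (xbar, 0) \<le> d" "L \<in> scd F z" "(ys, xs) \<in> L"
      then have "z \<in> gph F \<inter> cball (xbar, 0) d" "(ys, xs) \<in> \<Union> (scd F z)"
        by (auto simp: dist_commute)
      with d show "\<bar>xs \<bullet> (fst z - xbar) - ys \<bullet> snd z\<bar> \<le> \<epsilon> * norm (z - (xbar, 0)) * norm (xs, ys)"
        by fast
    qed
  qed
  \<comment> \<open>The approximation step may enlarge the distance by the factor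
    \<open>\<eta>\<close>, hence the division.\<close>
  define \<delta> where "\<delta> = min \<delta>1 \<delta>2 / \<eta>"
  have near: "dist z (xbar, 0) < \<delta>1" "dist z (xbar, 0) \<le> \<delta>2"
    if "dist x xbar < \<delta>" "newton_approx F xbar \<eta> x z" for x z
  proof -
    have "dist z (xbar, 0) \<le> \<eta> * dist x xbar"
      using that by (simp add: newton_approx_def dist_norm)
    also have "\<dots> < min \<delta>1 \<delta>2"
      using that(1) \<open>\<eta> > 0\<close> by (simp add: \<delta>_def field_simps)
    finally show "dist z (xbar, 0) < \<delta>1" "dist z (xbar, 0) \<le> \<delta>2"
      by auto
  qed
  \<comment> \<open>In the bound \<open>norm y \<le> \<kappa> * norm x\<close>, taking
    \<open>x = 0\<close> forces \<open>y = 0\<close>.\<close>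
  have regular: "L \<in> Zn_reg"
    if "dist x xbar < \<delta>" "newton_approx F xbar \<eta> x z" "L \<in> scd F z" for x z L
    using \<kappa>(3)[OF near(1)[OF that(1,2)] that(3)] that(3) by (fastforce simp: Zn_reg_def scd_def)
  show thesis
  proof (rule that[OF _ regular])
    show "\<delta> > 0"
      using \<kappa> \<delta>2 \<open>\<eta> > 0\<close> by (simp add: \<delta>_def)
    fix x z L x'
    assume x: "dist x xbar < \<delta>" "newton_approx F xbar \<eta> x z" and L: "L \<in> scd F z" and step: "newton_step z L x'"
    have z: "z \<in> gph F" "norm (z - (xbar, 0)) \<le> \<eta> * norm (x - xbar)"
      using x by (auto simp: newton_approx_def)
    have "norm (x' - xbar) \<le> \<epsilon> * (1 + \<kappa>) * norm (z - (xbar, 0))"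
      using \<kappa>(3)[OF near(1)[OF x] L] \<delta>2(2)[OF z(1) near(2)[OF x] L] \<open>\<epsilon> > 0\<close> \<kappa>(1)
      by (intro newton_step_error[OF step regular[OF x L]]) auto
    also have "\<dots> \<le> \<epsilon> * (1 + \<kappa>) * (\<eta> * norm (x - xbar))"
      using \<open>\<epsilon> > 0\<close> \<kappa>(1) z(2) by (intro mult_left_mono) auto
    also have "\<dots> = c * norm (x - xbar)"
    proof -
      have "\<epsilon> * ((1 + \<kappa>) * \<eta>) = c"
        using \<kappa>(1) \<open>\<eta> > 0\<close> by (simp add: \<epsilon>_def)
      then show ?thesis
        by (simp add: mult.assoc[symmetric])
    qed
    finally show "norm (x' - xbar) \<le> c * norm (x - xbar)" .
  qed
qed

section \<open>Convergence of the method\<close>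

theorem corollary5p6:
  fixes F :: "real^'n::finite \<Rightarrow> (real^'n) set" and xbar :: "real^'n"
  assumes "(xbar, 0) \<in> gph F"
    and "locally_closed_around (gph F) (xbar, 0)"
    and "scd_semismooth F (xbar, 0)"
    and "scd_regular F (xbar, 0)"
  shows "\<forall>\<eta>>0. \<exists>U. open U \<and> xbar \<in> U \<and>
    (\<forall>x0\<in>U.
       newton_well_defined F xbar \<eta> x0 \<and>
       newton_all_choices_admissible F xbar \<eta> x0 \<and>
       (\<forall>x z L. x 0 = x0 \<and> newton_run F xbar \<eta> x z L \<longrightarrow>
          (\<exists>N. 0 \<in> F (x N)) \<or> superlinearly_convergent x xbar))"
proof (intro allI impI)
  fix \<eta> :: real assume "\<eta> > 0"
  have reg: "scd F (xbar, 0) \<subseteq> Zn_reg" and "scd_property F (xbar, 0)"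
    using assms(4) by (auto simp: scd_regular_def)
  then obtain \<delta>0 where \<delta>0: "\<delta>0 > 0" "\<And>z. dist z (xbar, 0) < \<delta>0 \<Longrightarrow> z \<in> gph F \<Longrightarrow> scd F z \<noteq> {}"
    by (auto simp: scd_property_def eventually_nhds_metric)
  obtain \<delta>1 where \<delta>1: "\<delta>1 > 0"
    and regular: "\<And>x z L. dist x xbar < \<delta>1 \<Longrightarrow> newton_approx F xbar \<eta> x z \<Longrightarrow> L \<in> scd F z \<Longrightarrow> L \<in> Zn_reg"
    and half: "\<And>x z L x'. dist x xbar < \<delta>1 \<Longrightarrow> newton_approx F xbar \<eta> x z \<Longrightarrow> L \<in> scd F z \<Longrightarrow> newton_step z L x'
       \<Longrightarrow> norm (x' - xbar) \<le> 1 / 2 * norm (x - xbar)"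
    using newton_contraction[OF assms(3) reg \<open>\<eta> > 0\<close>, of "1 / 2"] by auto
  \<comment> \<open>Below \<open>\<delta>1\<close> the steps contract and the subspaces are regular;
    below \<open>\<delta>0 / \<eta>\<close> every admissible \<open>z\<close> lies where the SCD
    property holds.\<close>
  define \<rho> where "\<rho> = min \<delta>1 (\<delta>0 / \<eta>)"
  have "\<rho> > 0" "\<rho> \<le> \<delta>1"
    using \<delta>0 \<delta>1 \<open>\<eta> > 0\<close> by (auto simp: \<rho>_def)
  have nonempty: "scd F z \<noteq> {}" if "dist x xbar < \<rho>" "newton_approx F xbar \<eta> x z" for x z
  proof (rule \<delta>0(2))
    have "dist z (xbar, 0) \<le> \<eta> * dist x xbar"
      using that by (simp add: newton_approx_def dist_norm)
    also have "\<dots> < \<delta>0"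
      using that(1) \<open>\<eta> > 0\<close> by (simp add: \<rho>_def field_simps)
    finally show "dist z (xbar, 0) < \<delta>0" .
  qed (use that in \<open>simp add: newton_approx_def\<close>)
  have stays: "dist x' xbar < \<rho>"
    if "dist x xbar < \<rho>" "newton_approx F xbar \<eta> x z" "L \<in> scd F z" "newton_step z L x'" for x z L x'
    using half[OF _ that(2-4)] that(1) \<open>\<rho> \<le> \<delta>1\<close> norm_ge_zero[of "x - xbar"]
    unfolding dist_norm by linarith
  \<comment> \<open>Invariance of the ball along all chains of iterations, since well-definedness
    and admissibility quantify over reachable points.\<close>
  have reach: "dist x xbar < \<rho>" if "(newton_iteration F xbar \<eta>)\<^sup>*\<^sup>* x0 x" "dist x0 xbar < \<rho>" for x0 x
    using that
  proof (induction rule: rtranclp_induct)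
    case (step x x')
    then show ?case
      using stays by (auto simp: newton_iteration_def)
  qed
  show "\<exists>U. open U \<and> xbar \<in> U \<and> (\<forall>x0\<in>U. newton_well_defined F xbar \<eta> x0 \<and>
       newton_all_choices_admissible F xbar \<eta> x0 \<and>
       (\<forall>x z L. x 0 = x0 \<and> newton_run F xbar \<eta> x z L \<longrightarrow>
          (\<exists>N. 0 \<in> F (x N)) \<or> superlinearly_convergent x xbar))"
  proof (intro exI[of _ "ball xbar \<rho>"] conjI ballI allI impI)
    fix x0 assume "x0 \<in> ball xbar \<rho>"
    then have x0: "dist x0 xbar < \<rho>"
      by (simp add: dist_commute)
    show "newton_well_defined F xbar \<eta> x0"
      unfolding newton_well_defined_def
    proof (intro allI impI conjI)
      fix x assume "(newton_iteration F xbar \<eta>)\<^sup>*\<^sup>* x0 x \<and> 0 \<notin> F x"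
      then have x: "dist x xbar < \<rho>"
        using reach x0 by blast
      have "newton_approx F xbar \<eta> x (xbar, 0)"
        using assms(1) \<open>\<eta> > 0\<close> by (simp add: newton_approx_def)
      then show "\<exists>z. newton_approx F xbar \<eta> x z \<and> scd F z \<inter> Zn_reg \<noteq> {}"
        using nonempty[OF x] reg by blast
    next
      fix x z assume "newton_approx F xbar \<eta> x z \<and> scd F z \<inter> Zn_reg \<noteq> {}"
      then obtain L where "L \<in> scd F z" "L \<in> Zn_reg" by blast
      then show "\<exists>A B. rge (transpose B) (transpose A) \<in> scd F z \<inter> Zn_reg"
        by (metis Zn_reg_rge_cases IntI)
    next
      fix z :: "'n pt" and A B :: "real^'n^'n"
      assume "rge (transpose B) (transpose A) \<in> scd F z \<inter> Zn_reg"
      then show "\<exists>!\<Delta>. A *v \<Delta> = - (B *v snd z)"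
        by (intro invertible_ex1_solution invertible_of_rge_in_Zn_reg) auto
    qed
    show "newton_all_choices_admissible F xbar \<eta> x0"
      unfolding newton_all_choices_admissible_def
    proof (intro allI impI conjI ballI)
      fix x z assume "(newton_iteration F xbar \<eta>)\<^sup>*\<^sup>* x0 x \<and> 0 \<notin> F x" and z: "newton_approx F xbar \<eta> x z"
      then have x: "dist x xbar < \<rho>"
        using reach x0 by blast
      show "scd F z \<noteq> {}"
        by (rule nonempty[OF x z])
      fix L assume "L \<in> scd F z"
      then show "L \<in> Zn_reg"
        using regular[OF less_le_trans[OF x \<open>\<rho> \<le> \<delta>1\<close>] z] by simp
      then show "\<exists>x'. newton_step z L x'"
        by (rule newton_step_exists)
    qed
    fix x z L assume run: "x 0 = x0 \<and> newton_run F xbar \<eta> x z L"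
    show "(\<exists>N. 0 \<in> F (x N)) \<or> superlinearly_convergent x xbar"
    proof (rule disj_imp[THEN iffD2], rule impI)
      assume "\<nexists>N. 0 \<in> F (x N)"
      \<comment> \<open>With no solution among the iterates, the rules of the run are in force at
        every index.\<close>
      then have k: "newton_approx F xbar \<eta> (x k) (z k)" "L k \<in> scd F (z k)" "newton_step (z k) (L k) (x (Suc k))" for k
        using run by (auto simp: newton_run_def)
      have ball: "dist (x k) xbar < \<rho>" for k
      proof (induction k)
        case 0
        then show ?case using run x0 by simp
      next
        case (Suc j)
        then show ?case using stays k by blast
      qed
      show "superlinearly_convergent x xbar"
      proof (rule superlinearly_convergentI)
        show "norm (x (Suc j) - xbar) \<le> 1 / 2 * norm (x j - xbar)" for j
          using ball[of j] \<open>\<rho> \<le> \<delta>1\<close> by (intro half[OF _ k]) auto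
        fix c :: real assume "c > 0"
        \<comment> \<open>The radius obtained here depends on \<open>c\<close>, while the ball of
          starting points stays fixed.\<close>
        from newton_contraction[OF assms(3) reg \<open>\<eta> > 0\<close> this]
        show "\<exists>\<delta>>0. \<forall>j. dist (x j) xbar < \<delta> \<longrightarrow> norm (x (Suc j) - xbar) \<le> c * norm (x j - xbar)"
          using k by metis
      qed
    qed
  qed (use \<open>\<rho> > 0\<close> in auto)
qed

end
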